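(* Let $E$ be a complex Banach space with conjugate topological dual $\bar E'$, and let $A:E\supseteq\operatorname{dom}A\to\bar E'$ be a linear operator defined on a linear subspace $\operatorname{dom}A$ of $E$. Then the following statements are equivalent: (i) $A$ has a (continuous) positive extension $\widetilde A\in\mathscr{L}(E;\bar E')$. (ii) There is a constant $M\geq 0$ such that $\|Ax\|^2\leq M\cdot\langle Ax,x\rangle$ for all $x\in\operatorname{dom}A$. (iii) For any $y\in E$ there exists $M_y\geq 0$ such that $|\langle Ax,y\rangle|^2\leq M_y\cdot\langle Ax,x\rangle$ for all $x\in\operatorname{dom}A$. In any case (i.e. whenever these equivalent conditions hold), there exists the Krein--von Neumann extension $A_N$ of $A$, that is, the smallest among the positive extensions of $A$ in $\mathscr{L}(E;\bar E')$. The norm of $A_N$ satisfies $$\|A_N\|=\inf\{M\geq 0 : \|Ax\|^2\leq M\cdot\langle Ax,x\rangle\ \text{ for all } x\in\operatorname{dom}A\}.$$ If $B,C\in\mathscr{L}(E;E)$ are continuous operators leaving $\operatorname{dom}A$ invariant such that $C^*A\subset AB$ and $B^*A\subset AC$, then $$C^*A_N=A_NB\qquad\text{and}\qquad B^*A_N=A_NC.$$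
   Context: $\bar E'$ is the Banach space of continuous conjugate linear functionals on $E$, and $\langle f,x\rangle:=f(x)$ for $f\in\bar E'$, $x\in E$. $\mathscr{L}(E;\bar E')$ and $\mathscr{L}(E;E)$ denote the (everywhere defined) continuous linear operators. A linear operator $A:E\supseteq\operatorname{dom}A\to\bar E'$ is positive if $\langle Ax,x\rangle\geq 0$ for all $x\in\operatorname{dom}A$. For $S,T\in\mathscr{L}(E;\bar E')$, $S\leq T$ means $\langle(T-S)x,x\rangle\geq 0$ for all $x\in E$; "smallest" refers to this order. For $B\in\mathscr{L}(E;E)$, the adjoint $B^*:\bar E'\to\bar E'$ is given by $\langle B^*f,x\rangle=\langle f,Bx\rangle$. The inclusion $C^*A\subset AB$ means $C^*Ax=ABx$ for all $x\in\operatorname{dom}A$, and similarly for $B^*A\subset AC$. *)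

theory Defs
  imports "HOL-Analysis.Analysis" "HOL-Library.Complex_Order"
begin

section \<open>Complex Banach spaces\<close>

text \<open>The distribution only has real normed spaces. A complex normed space is a real normed space
  with a compatible multiplication by complex scalars, so that all metric and topological notions
  (norm, \<^const>\<open>bounded_linear\<close>, \<^const>\<open>onorm\<close>, completeness) are inherited from the library.\<close>

class complex_vector = real_vector +
  fixes scaleC :: "complex \<Rightarrow> 'a \<Rightarrow> 'a" (infixr \<open>*\<^sub>C\<close> 75)
  assumes scaleC_add_right: "a *\<^sub>C (x + y) = a *\<^sub>C x + a *\<^sub>C y"
    and scaleC_add_left: "(a + b) *\<^sub>C x = a *\<^sub>C x + b *\<^sub>C x"
    and scaleC_scaleC: "a *\<^sub>C b *\<^sub>C x = (a * b) *\<^sub>C x"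
    and scaleC_one: "1 *\<^sub>C x = x"
    and scaleR_scaleC: "r *\<^sub>R x = complex_of_real r *\<^sub>C x"

class complex_normed_vector = complex_vector + real_normed_vector +
  assumes norm_scaleC: "norm (a *\<^sub>C x) = cmod a * norm x"

class cbanach = complex_normed_vector + banach

global_interpretation complex_vector: vector_space "scaleC :: complex \<Rightarrow> 'a \<Rightarrow> 'a :: complex_vector"
  defines csubspace = complex_vector.subspace
  by unfold_locales (rule scaleC_add_right scaleC_add_left scaleC_scaleC scaleC_one)+

instantiation complex :: cbanach
begin

definition scaleC_complex :: "complex \<Rightarrow> complex \<Rightarrow> complex"
  where "scaleC_complex a x = a * x"

instance
  by standard (auto simp: scaleC_complex_def algebra_simps norm_mult scaleR_conv_of_real)

end

section \<open>Linear operators\<close>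

text \<open>A partially defined operator is a total function together with its domain; its values off
  the domain are irrelevant.\<close>

definition clinear_on :: "'a::complex_vector set \<Rightarrow> ('a \<Rightarrow> 'b::complex_vector) \<Rightarrow> bool"
  where "clinear_on D A \<longleftrightarrow> (\<forall>x\<in>D. \<forall>y\<in>D. A (x + y) = A x + A y) \<and>
    (\<forall>c. \<forall>x\<in>D. A (c *\<^sub>C x) = c *\<^sub>C A x)"

definition bounded_clinear :: "('a::complex_normed_vector \<Rightarrow> 'b::complex_normed_vector) \<Rightarrow> bool"
  where "bounded_clinear T \<longleftrightarrow> clinear_on UNIV T \<and> bounded_linear T"

section \<open>The conjugate dual\<close>

text \<open>A continuous conjugate linear functional is in particular a bounded real-linear map, so the
  conjugate dual is a (closed) subset of the library's space of such maps, with the operator norm.\<close>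

typedef (overloaded) 'a antidual =
  "{f :: 'a::complex_normed_vector \<Rightarrow>\<^sub>L complex. \<forall>c x. blinfun_apply f (c *\<^sub>C x) = cnj c * blinfun_apply f x}"
  by (rule exI[of _ 0]) simp

setup_lifting type_definition_antidual

lift_definition pairing :: "'a::complex_normed_vector antidual \<Rightarrow> 'a \<Rightarrow> complex" (\<open>\<langle>_,/ _\<rangle>\<close>)
  is blinfun_apply .

instantiation antidual :: (complex_normed_vector) complex_normed_vector
begin

lift_definition norm_antidual :: "'a antidual \<Rightarrow> real" is norm .

lift_definition zero_antidual :: "'a antidual" is 0 by simp

lift_definition plus_antidual :: "'a antidual \<Rightarrow> 'a antidual \<Rightarrow> 'a antidual" is "(+)"
  by (simp add: blinfun.bilinear_simps algebra_simps)

lift_definition minus_antidual :: "'a antidual \<Rightarrow> 'a antidual \<Rightarrow> 'a antidual" is "(-)"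
  by (simp add: blinfun.bilinear_simps algebra_simps)

lift_definition uminus_antidual :: "'a antidual \<Rightarrow> 'a antidual" is "uminus"
  by (simp add: blinfun.bilinear_simps)

lift_definition scaleR_antidual :: "real \<Rightarrow> 'a antidual \<Rightarrow> 'a antidual" is "scaleR"
  by (simp add: blinfun.bilinear_simps)

text \<open>The complex vector space structure is the pointwise one: \<open>(c f)(x) = c \<cdot> f(x)\<close>.\<close>

lift_definition scaleC_antidual :: "complex \<Rightarrow> 'a antidual \<Rightarrow> 'a antidual"
  is "\<lambda>c f. blinfun_compose (Blinfun ((*) c)) f"
  by (simp add: bounded_linear_mult_right bounded_linear_Blinfun_apply)

definition sgn_antidual :: "'a antidual \<Rightarrow> 'a antidual"
  where "sgn_antidual f = inverse (norm f) *\<^sub>R f"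

definition dist_antidual :: "'a antidual \<Rightarrow> 'a antidual \<Rightarrow> real"
  where "dist_antidual f g = norm (f - g)"

definition uniformity_antidual :: "('a antidual \<times> 'a antidual) filter"
  where "uniformity_antidual = (INF e\<in>{0<..}. principal {(f, g). dist f g < e})"

definition open_antidual :: "'a antidual set \<Rightarrow> bool"
  where "open_antidual S \<longleftrightarrow> (\<forall>f\<in>S. \<forall>\<^sub>F (f', g) in uniformity. f' = f \<longrightarrow> g \<in> S)"

instance
proof
  fix f g h :: "'a antidual" and a b :: complex and r s :: real and S :: "'a antidual set"
  have mult: "blinfun_apply (Blinfun ((*) c)) z = c * z" for c z :: complex
    by (simp add: bounded_linear_mult_right bounded_linear_Blinfun_apply)
  show "f + g + h = f + (g + h)" by transfer (simp add: algebra_simps)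
  show "f + g = g + f" by transfer (simp add: algebra_simps)
  show "0 + f = f" by transfer simp
  show "- f + f = 0" by transfer simp
  show "f - g = f + - g" by transfer simp
  show "r *\<^sub>R (f + g) = r *\<^sub>R f + r *\<^sub>R g" by transfer (simp add: algebra_simps)
  show "(r + s) *\<^sub>R f = r *\<^sub>R f + s *\<^sub>R f" by transfer (simp add: algebra_simps)
  show "r *\<^sub>R s *\<^sub>R f = (r * s) *\<^sub>R f" by transfer simp
  show "1 *\<^sub>R f = f" by transfer simp
  show "a *\<^sub>C (f + g) = a *\<^sub>C f + a *\<^sub>C g"
    by transfer (auto intro!: blinfun_eqI simp: mult blinfun.bilinear_simps algebra_simps)
  show "(a + b) *\<^sub>C f = a *\<^sub>C f + b *\<^sub>C f"
    by transfer (auto intro!: blinfun_eqI simp: mult blinfun.bilinear_simps algebra_simps)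
  show "a *\<^sub>C b *\<^sub>C f = (a * b) *\<^sub>C f"
    by transfer (auto intro!: blinfun_eqI simp: mult)
  show "1 *\<^sub>C f = f"
    by transfer (auto intro!: blinfun_eqI simp: mult)
  show "r *\<^sub>R f = complex_of_real r *\<^sub>C f"
    by transfer (auto intro!: blinfun_eqI simp: mult blinfun.bilinear_simps scaleR_conv_of_real)
  show "dist f g = norm (f - g)" by (rule dist_antidual_def)
  show "sgn f = inverse (norm f) *\<^sub>R f" by (rule sgn_antidual_def)
  show "uniformity = (INF e\<in>{0<..}. principal {(f :: 'a antidual, g). dist f g < e})"
    by (rule uniformity_antidual_def)
  show "open S \<longleftrightarrow> (\<forall>f\<in>S. \<forall>\<^sub>F (f', g) in uniformity. f' = f \<longrightarrow> g \<in> S)"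
    by (rule open_antidual_def)
  show "(norm f = 0) = (f = 0)" by transfer simp
  show "norm (f + g) \<le> norm f + norm g" by transfer (rule norm_triangle_ineq)
  show "norm (r *\<^sub>R f) = \<bar>r\<bar> * norm f" by transfer simp
  have le: "norm (c *\<^sub>C k) \<le> cmod c * norm k" for c and k :: "'a antidual"
  proof transfer
    fix c and k :: "'a \<Rightarrow>\<^sub>L complex"
    have "norm (Blinfun ((*) c) o\<^sub>L k) \<le> norm (Blinfun ((*) c)) * norm k"
      by (rule norm_blinfun_compose)
    also have "norm (Blinfun ((*) c)) \<le> cmod c"
      by (rule norm_blinfun_bound) (simp_all add: mult norm_mult)
    finally show "norm (Blinfun ((*) c) o\<^sub>L k) \<le> cmod c * norm k"
      by (simp add: mult_right_mono)
  qed
  have one: "1 *\<^sub>C f = f"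
    by transfer (auto intro!: blinfun_eqI simp: mult)
  have assoc: "inverse a *\<^sub>C a *\<^sub>C f = (inverse a * a) *\<^sub>C f"
    by transfer (auto intro!: blinfun_eqI simp: mult)
  show "norm (a *\<^sub>C f) = cmod a * norm f"
  proof (cases "a = 0")
    case True
    have "norm (a *\<^sub>C f) = 0"
      using le[of a f] True by (metis norm_antidual.rep_eq norm_ge_zero norm_zero mult_zero_left order_antisym)
    then show ?thesis using True by simp
  next
    case False
    have "norm f \<le> cmod (inverse a) * norm (a *\<^sub>C f)"
      using le[of "inverse a" "a *\<^sub>C f"] False by (simp add: assoc one)
    then have "cmod a * norm f \<le> norm (a *\<^sub>C f)"
      using False by (simp add: norm_inverse norm_divide field_simps)
    with le[of a f] show ?thesis by simp
  qed
qed

end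

instance antidual :: (complex_normed_vector) cbanach
proof
  fix X :: "nat \<Rightarrow> 'a antidual"
  have dist_Rep: "dist f g = dist (Rep_antidual f) (Rep_antidual g)" for f g :: "'a antidual"
    by (simp add: dist_norm norm_antidual.rep_eq minus_antidual.rep_eq)
  assume "Cauchy X"
  then have "Cauchy (\<lambda>n. Rep_antidual (X n))"
    unfolding Cauchy_def dist_Rep .
  then obtain L where L: "(\<lambda>n. Rep_antidual (X n)) \<longlonglongrightarrow> L"
    using Cauchy_convergent convergent_def by blast
  have lim: "(\<lambda>n. blinfun_apply (Rep_antidual (X n)) x) \<longlonglongrightarrow> blinfun_apply L x" for x
    using L by (intro tendsto_intros)
  have "blinfun_apply L (c *\<^sub>C x) = cnj c * blinfun_apply L x" for c x
  proof (rule LIMSEQ_unique[OF lim])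
    have "blinfun_apply (Rep_antidual (X n)) (c *\<^sub>C x) = cnj c * blinfun_apply (Rep_antidual (X n)) x" for n
      using Rep_antidual[of "X n"] by simp
    then show "(\<lambda>n. blinfun_apply (Rep_antidual (X n)) (c *\<^sub>C x)) \<longlonglongrightarrow> cnj c * blinfun_apply L x"
      by (simp add: tendsto_mult_left lim)
  qed
  then have "Rep_antidual (Abs_antidual L) = L"
    by (simp add: Abs_antidual_inverse)
  with L have "X \<longlonglongrightarrow> Abs_antidual L"
    unfolding LIMSEQ_def dist_Rep by simp
  then show "convergent X" by (rule convergentI)
qed

lemma pairing_eqI: "(\<And>x. \<langle>f, x\<rangle> = \<langle>g, x\<rangle>) \<Longrightarrow> f = g"
  by transfer (rule blinfun_eqI)

lemma bounded_linear_pairing: "bounded_linear (pairing f)"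
  by transfer (rule blinfun.bounded_linear_right)

lemma pairing_scaleC_right: "\<langle>f, c *\<^sub>C x\<rangle> = cnj c * \<langle>f, x\<rangle>"
  by transfer simp

lemma pairing_scaleC_left: "\<langle>c *\<^sub>C f, x\<rangle> = c * \<langle>f, x\<rangle>"
  by transfer (simp add: bounded_linear_mult_right bounded_linear_Blinfun_apply)

lemma pairing_add_left: "\<langle>f + g, x\<rangle> = \<langle>f, x\<rangle> + \<langle>g, x\<rangle>"
  by transfer (simp add: blinfun.bilinear_simps)

lemma pairing_diff_left: "\<langle>f - g, x\<rangle> = \<langle>f, x\<rangle> - \<langle>g, x\<rangle>"
  by transfer (simp add: blinfun.bilinear_simps)

lemma norm_antidual_eq_onorm: "norm f = onorm (pairing f)"
  by transfer (simp add: norm_blinfun.rep_eq)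

lemma antidual_exists:
  assumes "bounded_linear \<phi>" "\<And>c x. \<phi> (c *\<^sub>C x) = cnj c * \<phi> x"
  shows "\<exists>f. \<forall>x. \<langle>f, x\<rangle> = \<phi> x"
proof -
  have "pairing (Abs_antidual (Blinfun \<phi>)) x = \<phi> x" for x
    using assms by (simp add: pairing.rep_eq Abs_antidual_inverse bounded_linear_Blinfun_apply)
  then show ?thesis by blast
qed

definition cadjoint :: "('a::complex_normed_vector \<Rightarrow> 'a) \<Rightarrow> 'a antidual \<Rightarrow> 'a antidual"
  where "cadjoint B f = (THE g. \<forall>x. \<langle>g, x\<rangle> = \<langle>f, B x\<rangle>)"

lemma pairing_cadjoint:
  assumes "bounded_clinear B"
  shows "\<langle>cadjoint B f, x\<rangle> = \<langle>f, B x\<rangle>"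
proof -
  have "\<exists>g. \<forall>x. \<langle>g, x\<rangle> = \<langle>f, B x\<rangle>"
  proof (rule antidual_exists)
    show "bounded_linear (\<lambda>x. \<langle>f, B x\<rangle>)"
      using assms unfolding bounded_clinear_def
      by (blast intro: bounded_linear_compose[OF bounded_linear_pairing])
    show "\<langle>f, B (c *\<^sub>C x)\<rangle> = cnj c * \<langle>f, B x\<rangle>" for c x
      using assms by (simp add: bounded_clinear_def clinear_on_def pairing_scaleC_right)
  qed
  then have "\<exists>!g. \<forall>x. \<langle>g, x\<rangle> = \<langle>f, B x\<rangle>"
    by (metis pairing_eqI)
  from theI'[OF this] show ?thesis
    unfolding cadjoint_def by blast
qed

section \<open>Positive operators and extensions\<close>

text \<open>The order on \<^typ>\<open>complex\<close> is the one of \<^theory>\<open>HOL-Library.Complex_Order\<close>: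
  \<open>z \<le> w\<close> means that \<open>w - z\<close> is real and nonnegative.\<close>

definition positive_on :: "'a::complex_normed_vector set \<Rightarrow> ('a \<Rightarrow> 'a antidual) \<Rightarrow> bool"
  where "positive_on D A \<longleftrightarrow> (\<forall>x\<in>D. 0 \<le> \<langle>A x, x\<rangle>)"

definition op_le :: "('a::complex_normed_vector \<Rightarrow> 'a antidual) \<Rightarrow> ('a \<Rightarrow> 'a antidual) \<Rightarrow> bool"
  where "op_le S T \<longleftrightarrow> (\<forall>x. 0 \<le> \<langle>T x - S x, x\<rangle>)"

definition positive_extension ::
  "'a::complex_normed_vector set \<Rightarrow> ('a \<Rightarrow> 'a antidual) \<Rightarrow> ('a \<Rightarrow> 'a antidual) \<Rightarrow> bool"
  where "positive_extension D A T \<longleftrightarrow>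
    bounded_clinear T \<and> positive_on UNIV T \<and> (\<forall>x\<in>D. T x = A x)"

definition krein_von_neumann_extension ::
  "'a::complex_normed_vector set \<Rightarrow> ('a \<Rightarrow> 'a antidual) \<Rightarrow> ('a \<Rightarrow> 'a antidual) \<Rightarrow> bool"
  where "krein_von_neumann_extension D A N \<longleftrightarrow>
    positive_extension D A N \<and> (\<forall>T. positive_extension D A T \<longrightarrow> op_le N T)"

end

theory Submission
  imports Defs
begin

text \<open>Under (ii), \<open>\<langle>A x, y\<rangle>\<close> is a semi-inner product on \<open>dom A\<close>, with seminorm \<open>p\<close> say, and \<open>A\<close> is
  bounded from \<open>p\<close> to the norm of the conjugate dual. For \<open>y \<in> E\<close> a sequence \<open>x\<^sub>n \<in> dom A\<close> minimizing
  \<open>\<langle>A x, x\<rangle> - 2 Re \<langle>A x, y\<rangle>\<close> is \<open>p\<close>-Cauchy, and \<open>A\<^sub>N y = lim A x\<^sub>n\<close>. Here \<open>A x\<^sub>n\<close> stands for the element of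
  the completion of \<open>ran A\<close> that represents the functional \<open>A z \<mapsto> \<langle>A z, y\<rangle>\<close>, so this is the factorization
  \<open>A\<^sub>N = J J\<^sup>*\<close> through that Hilbert space, without constructing the space. Moreover
  \<open>\<langle>A\<^sub>N y, y\<rangle> = lim \<langle>A x\<^sub>n, x\<^sub>n\<rangle>\<close>, so for a positive extension \<open>T\<close> the Cauchy-Schwarz inequality
  \<open>\<bar>\<langle>A x\<^sub>n, y\<rangle>\<bar>\<^sup>2 \<le> \<langle>A x\<^sub>n, x\<^sub>n\<rangle> \<langle>T y, y\<rangle>\<close> yields \<open>\<langle>A\<^sub>N y, y\<rangle> \<le> \<langle>T y, y\<rangle>\<close>. That (iii) implies (ii) is the
  uniform boundedness principle.\<close>

section \<open>The pairing and elementary inequalities\<close>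

lemma pairing_bilinear:
  "\<langle>f, x + y\<rangle> = \<langle>f, x\<rangle> + \<langle>f, y\<rangle>" "\<langle>f, x - y\<rangle> = \<langle>f, x\<rangle> - \<langle>f, y\<rangle>"
  "\<langle>f, - x\<rangle> = - \<langle>f, x\<rangle>" "\<langle>f, 0\<rangle> = 0"
  "\<langle>f + g, x\<rangle> = \<langle>f, x\<rangle> + \<langle>g, x\<rangle>" "\<langle>f - g, x\<rangle> = \<langle>f, x\<rangle> - \<langle>g, x\<rangle>" "\<langle>0, x\<rangle> = 0"
  "\<langle>f, c *\<^sub>C x\<rangle> = cnj c * \<langle>f, x\<rangle>" "\<langle>c *\<^sub>C f, x\<rangle> = c * \<langle>f, x\<rangle>"
proof -
  interpret bounded_linear "pairing f" by (rule bounded_linear_pairing)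
  show "\<langle>f, x + y\<rangle> = \<langle>f, x\<rangle> + \<langle>f, y\<rangle>" "\<langle>f, x - y\<rangle> = \<langle>f, x\<rangle> - \<langle>f, y\<rangle>"
    "\<langle>f, - x\<rangle> = - \<langle>f, x\<rangle>" "\<langle>f, 0\<rangle> = 0"
    by (simp_all add: add diff neg zero)
  show "\<langle>0, x\<rangle> = 0" by transfer simp
qed (simp_all add: pairing_add_left pairing_diff_left pairing_scaleC_right pairing_scaleC_left)

lemma cmod_pairing_le: "cmod \<langle>f, x\<rangle> \<le> norm f * norm x"
  using onorm[OF bounded_linear_pairing] by (simp add: norm_antidual_eq_onorm)

lemma norm_antidual_le:
  assumes "\<And>x. cmod \<langle>f, x\<rangle> \<le> b * norm x" "0 \<le> b"
  shows "norm f \<le> b"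
  using assms by (simp add: norm_antidual_eq_onorm onorm_bound)

lemma tendsto_pairing:
  assumes "(F \<longlongrightarrow> f) G"
  shows "((\<lambda>n. \<langle>F n, v\<rangle>) \<longlongrightarrow> \<langle>f, v\<rangle>) G"
proof -
  have "((\<lambda>n. F n - f) \<longlongrightarrow> 0) G"
    using assms by (simp add: LIM_zero)
  then have "((\<lambda>n. norm (F n - f) * norm v) \<longlongrightarrow> 0) G"
    by (auto intro: tendsto_mult_left_zero tendsto_norm_zero)
  then have "((\<lambda>n. \<langle>F n, v\<rangle> - \<langle>f, v\<rangle>) \<longlongrightarrow> 0) G"
    by (rule Lim_null_comparison[rotated])
      (auto intro!: always_eventually simp: cmod_pairing_le simp flip: pairing_diff_left)
  then show ?thesis by (rule LIM_zero_cancel)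
qed

lemma complex_of_real_le_mult_iff:
  "0 \<le> z \<Longrightarrow> complex_of_real a \<le> complex_of_real b * z \<longleftrightarrow> a \<le> b * Re z"
  by (auto simp: less_eq_complex_def)

text \<open>In (ii) and (iii) positivity of \<open>A\<close> is hidden in the complex order: the
  right-hand side must be real and at least \<open>a > 0\<close>, which forces \<open>b > 0\<close>
  and hence \<open>z\<close> real and positive.\<close>

lemma nonneg_if_le_mult:
  assumes "complex_of_real a \<le> complex_of_real b * z" "0 < a" "0 \<le> b"
  shows "0 \<le> z"
proof -
  have le: "a \<le> b * Re z" and im: "b * Im z = 0"
    using assms(1) by (auto simp: less_eq_complex_def)
  have "0 < b * Re z" using le assms(2) by linarith
  then have "0 < b" "0 < Re z" using assms(3) by (auto simp: zero_less_mult_iff)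
  then show ?thesis using im by (simp add: less_eq_complex_def)
qed

lemma bounded_clinear_compose:
  "bounded_clinear S \<Longrightarrow> bounded_clinear T \<Longrightarrow> bounded_clinear (\<lambda>x. S (T x))"
  by (auto simp: bounded_clinear_def clinear_on_def intro: bounded_linear_compose)

text \<open>Discriminant argument behind Cauchy-Schwarz, with \<open>a\<close> a squared modulus and
  \<open>b\<close>, \<open>d\<close> values of a form that may vanish. The minimum is at
  \<open>t = 1/b\<close>; for \<open>b = 0\<close> an affine function of \<open>t\<close> stays
  nonnegative only if \<open>a = 0\<close>.\<close>

lemma discriminant_le:
  fixes a b d :: real
  assumes "\<And>t. 0 \<le> t\<^sup>2 * a * b - 2 * t * a + d" "0 \<le> a" "0 \<le> b"
  shows "a \<le> b * d"
proof (cases "b = 0")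
  case True
  have "a = 0"
  proof (rule ccontr)
    assume "a \<noteq> 0"
    \<comment> \<open>This \<open>t\<close> makes the affine function equal to -1.\<close>
    then show False using assms(1)[of "(d + 1) / (2 * a)"] True by simp
  qed
  then show ?thesis using True by simp
next
  case False
  then show ?thesis using assms(1)[of "1/b"] \<open>0 \<le> b\<close>
    by (simp add: field_simps power2_eq_square)
qed

text \<open>Log-convexity makes the ratios of consecutive terms nondecreasing, so a first ratio
  \<open>r > K\<close> would give growth at least like \<open>r ^ n\<close>, beyond any multiple of
  \<open>K ^ n\<close>.\<close>

lemma log_convex_le:
  fixes a :: "nat \<Rightarrow> real"
  assumes pos: "\<And>n. 0 \<le> a n"
    and conv: "\<And>n. (a (Suc n))\<^sup>2 \<le> a n * a (Suc (Suc n))"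
    and bound: "\<And>n. a n \<le> c * K ^ n" and "0 \<le> K"
  shows "a 1 \<le> K * a 0"
proof (rule ccontr)
  assume "\<not> a 1 \<le> K * a 0"
  then have less: "K * a 0 < a 1" by simp
  then have "0 < a 1" using pos[of 0] \<open>0 \<le> K\<close> by (smt (verit) mult_nonneg_nonneg)
  then have "0 < (a 1)\<^sup>2" by simp
  then have a0: "0 < a 0" using conv[of 0] pos[of 0] by (cases "a 0 = 0") auto
  define r where "r = a 1 / a 0"
  have r: "K < r" using less a0 by (simp add: r_def field_simps)
  then have "0 < r" using \<open>0 \<le> K\<close> by simp
  \<comment> \<open>Positivity is carried through the induction because the next ratio is obtained
    by cancelling \<open>a n\<close>.\<close>
  have step: "0 < a n \<and> r * a n \<le> a (Suc n)" for n
  proof (induction n)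
    case 0
    then show ?case using a0 by (simp add: r_def)
  next
    case (Suc n)
    then have p: "0 < a (Suc n)" using \<open>0 < r\<close> by (smt (verit) mult_pos_pos)
    have "a n * (r * a (Suc n)) \<le> a (Suc n) * a (Suc n)"
      using mult_right_mono[of "r * a n" "a (Suc n)" "a (Suc n)"] Suc p by (simp add: algebra_simps)
    also have "\<dots> \<le> a n * a (Suc (Suc n))" using conv[of n] by (simp add: power2_eq_square)
    finally show ?case using Suc p by simp
  qed
  have lower: "r ^ n * a 0 \<le> a n" for n
  proof (induction n)
    case (Suc n)
    then have "r * (r ^ n * a 0) \<le> r * a n" using \<open>0 < r\<close> by simp
    also have "\<dots> \<le> a (Suc n)" using step by simp
    finally show ?case by (simp add: algebra_simps)
  qed simp
  show False
  proof (cases "K = 0")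
    case True
    then show False using bound[of 1] \<open>0 < a 1\<close> by simp
  next
    case False
    then have K: "0 < K" using \<open>0 \<le> K\<close> by simp
    then obtain n where "c / a 0 < (r / K) ^ n"
      using real_arch_pow[of "r / K" "c / a 0"] r by auto
    then have "c * K ^ n < r ^ n * a 0" using a0 K by (simp add: field_simps power_divide)
    then show False using lower[of n] bound[of n] by simp
  qed
qed

section \<open>The semi-inner product of a positive operator\<close>

locale positive_form =
  fixes D :: "'a::complex_normed_vector set" and A :: "'a \<Rightarrow> 'a antidual"
  assumes subspace: "csubspace D" and linear: "clinear_on D A" and positive: "positive_on D A"
begin

lemma mem_add: "x \<in> D \<Longrightarrow> y \<in> D \<Longrightarrow> x + y \<in> D"
  and mem_diff: "x \<in> D \<Longrightarrow> y \<in> D \<Longrightarrow> x - y \<in> D"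
  and mem_scaleC: "x \<in> D \<Longrightarrow> c *\<^sub>C x \<in> D"
  and mem_zero: "0 \<in> D"
  using subspace
  by (auto intro: complex_vector.subspace_add complex_vector.subspace_diff
      complex_vector.subspace_scale complex_vector.subspace_0)

lemma A_add: "x \<in> D \<Longrightarrow> y \<in> D \<Longrightarrow> A (x + y) = A x + A y"
  and A_scaleC: "x \<in> D \<Longrightarrow> A (c *\<^sub>C x) = c *\<^sub>C A x"
  using linear by (auto simp: clinear_on_def)

lemma A_diff: "x \<in> D \<Longrightarrow> y \<in> D \<Longrightarrow> A (x - y) = A x - A y"
  using A_add[of "x - y" y] mem_diff by simp

definition q :: "'a \<Rightarrow> real" where "q x = Re \<langle>A x, x\<rangle>"

definition p :: "'a \<Rightarrow> real" where "p x = sqrt (q x)"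

lemma pairing_self: "x \<in> D \<Longrightarrow> \<langle>A x, x\<rangle> = complex_of_real (q x)"
  using positive by (auto simp: positive_on_def q_def less_eq_complex_def complex_eq_iff)

lemma q_nonneg: "x \<in> D \<Longrightarrow> 0 \<le> q x"
  using positive by (auto simp: positive_on_def q_def less_eq_complex_def)

lemma p_nonneg: "x \<in> D \<Longrightarrow> 0 \<le> p x"
  by (simp add: p_def q_nonneg)

lemma p_power2: "x \<in> D \<Longrightarrow> (p x)\<^sup>2 = q x"
  by (simp add: p_def q_nonneg)

text \<open>Polarization: the form is real on the diagonal, and the cross terms at
  \<open>x + c y\<close> with \<open>c = 1\<close> and \<open>c = \<i>\<close> yield the imaginary
  and the real part of the identity.\<close>

lemma hermitian:
  assumes "x \<in> D" "y \<in> D"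
  shows "\<langle>A y, x\<rangle> = cnj \<langle>A x, y\<rangle>"
proof -
  have "Im \<langle>A (x + c *\<^sub>C y), x + c *\<^sub>C y\<rangle> = 0" for c
    using pairing_self[of "x + c *\<^sub>C y"] assms by (simp add: mem_add mem_scaleC)
  moreover have "\<langle>A (x + c *\<^sub>C y), x + c *\<^sub>C y\<rangle> =
      q x + cnj c * \<langle>A x, y\<rangle> + c * \<langle>A y, x\<rangle> + c * cnj c * q y" for c
    using assms by (simp add: A_add A_scaleC mem_scaleC pairing_bilinear pairing_self algebra_simps)
  ultimately have "Im (q x + cnj c * \<langle>A x, y\<rangle> + c * \<langle>A y, x\<rangle> + c * cnj c * q y) = 0" for c
    by metis
  from this[of 1] this[of \<i>] show ?thesis by (simp add: complex_eq_iff)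
qed

lemma q_add_scaleC:
  assumes "x \<in> D" "y \<in> D"
  shows "q (x + c *\<^sub>C y) = q x + 2 * Re (c * \<langle>A y, x\<rangle>) + (cmod c)\<^sup>2 * q y"
proof -
  have "\<langle>A (x + c *\<^sub>C y), x + c *\<^sub>C y\<rangle> =
      q x + (cnj (c * \<langle>A y, x\<rangle>) + c * \<langle>A y, x\<rangle>) + c * cnj c * q y"
    using assms hermitian[of x y]
    by (simp add: A_add A_scaleC mem_scaleC pairing_bilinear pairing_self algebra_simps)
  then show ?thesis
    unfolding q_def[of "x + c *\<^sub>C y"] by (simp add: complex_mult_cnj cmod_power2 flip: of_real_power)
qed

lemma cauchy_schwarz_power2:
  assumes "x \<in> D" "y \<in> D"
  shows "(cmod \<langle>A x, y\<rangle>)\<^sup>2 \<le> q x * q y"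
proof -
  let ?w = "\<langle>A x, y\<rangle>"
  have "0 \<le> t\<^sup>2 * (cmod ?w)\<^sup>2 * q x - 2 * t * (cmod ?w)\<^sup>2 + q y" for t :: real
  proof -
    \<comment> \<open>The factor \<open>cnj ?w\<close> turns the cross term into the real number
      \<open>- 2 * t * (cmod ?w)\<^sup>2\<close>, so the expression is a real quadratic in
      \<open>t\<close>.\<close>
    have "0 \<le> q (y + (- of_real t * cnj ?w) *\<^sub>C x)"
      using assms by (intro q_nonneg mem_add mem_scaleC)
    also have "\<dots> = q y - 2 * t * (cmod ?w)\<^sup>2 + t\<^sup>2 * (cmod ?w)\<^sup>2 * q x"
    proof -
      have "- of_real t * cnj ?w * ?w = of_real (- t * (cmod ?w)\<^sup>2)"
        by (simp add: complex_norm_square[unfolded of_real_power])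
      then have "Re (- of_real t * cnj ?w * ?w) = - t * (cmod ?w)\<^sup>2"
        by (metis Re_complex_of_real)
      then show ?thesis
        using assms by (subst q_add_scaleC) (simp_all add: norm_mult power_mult_distrib)
    qed
    finally show ?thesis by simp
  qed
  then show ?thesis by (rule discriminant_le) (use assms q_nonneg in auto)
qed

lemma cauchy_schwarz:
  assumes "x \<in> D" "y \<in> D"
  shows "cmod \<langle>A x, y\<rangle> \<le> p x * p y"
  by (rule power2_le_imp_le)
    (use cauchy_schwarz_power2[OF assms] assms in \<open>simp_all add: power_mult_distrib p_power2 p_nonneg\<close>)

end

section \<open>Construction of the smallest positive extension\<close>

locale bounded_positive_form = positive_form D A
  for D :: "'a::complex_normed_vector set" and A :: "'a \<Rightarrow> 'a antidual" +
  fixes M :: real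
  assumes M_nonneg: "0 \<le> M" and norm_A_power2: "\<And>x. x \<in> D \<Longrightarrow> (norm (A x))\<^sup>2 \<le> M * q x"
begin

lemma norm_A: "x \<in> D \<Longrightarrow> norm (A x) \<le> sqrt M * p x"
  by (rule power2_le_imp_le)
    (simp_all add: norm_A_power2 power_mult_distrib p_power2 p_nonneg M_nonneg)

lemma cmod_pairing_A: "x \<in> D \<Longrightarrow> cmod \<langle>A x, y\<rangle> \<le> sqrt M * norm y * p x"
proof -
  assume "x \<in> D"
  then have "norm (A x) * norm y \<le> sqrt M * p x * norm y"
    by (intro mult_right_mono norm_A) auto
  then show ?thesis using cmod_pairing_le[of "A x" y] by (simp add: algebra_simps)
qed

text \<open>A dual bound tested at the vector itself: \<open>\<langle>A x, x\<rangle>\<close> is the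
  square of \<open>p x\<close>, and one factor cancels unless it is 0.\<close>

lemma p_le_of_dual:
  assumes "x \<in> D" "cmod \<langle>A x, x\<rangle> \<le> b * p x" "0 \<le> b"
  shows "p x \<le> b"
proof (cases "p x = 0")
  case False
  have "p x * p x \<le> b * p x"
    using assms by (simp add: pairing_self q_nonneg p_power2 flip: power2_eq_square)
  then show ?thesis using False p_nonneg[OF assms(1)] by simp
qed (use assms in simp)

lemma p_le_norm: "x \<in> D \<Longrightarrow> p x \<le> sqrt M * norm x"
  by (rule p_le_of_dual) (simp_all add: cmod_pairing_A M_nonneg)

text \<open>With \<open>J\<close> as above, \<open>approximates x y e\<close> says that \<open>A x\<close> lies within \<open>e\<close> of \<open>J\<^sup>* y\<close>; the condition on
  \<open>z\<close> is the dual form of this norm inequality.\<close>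

definition approximates :: "'a \<Rightarrow> 'a \<Rightarrow> real \<Rightarrow> bool" where
  "approximates x y e \<longleftrightarrow> x \<in> D \<and> 0 \<le> e \<and> (\<forall>z\<in>D. cmod \<langle>A z, y - x\<rangle> \<le> e * p z)"

text \<open>This is the relation \<open>f = J J\<^sup>* y\<close>. The convergence of
  \<open>A (X n)\<close> is only pointwise, which passes directly through linear combinations and
  adjoints.\<close>

definition represents :: "'a antidual \<Rightarrow> 'a \<Rightarrow> bool" where
  "represents f y \<longleftrightarrow> (\<exists>X e. e \<longlonglongrightarrow> 0 \<and> (\<forall>n. approximates (X n) y (e n)) \<and>
    (\<forall>v. (\<lambda>n. \<langle>A (X n), v\<rangle>) \<longlonglongrightarrow> \<langle>f, v\<rangle>))"

lemma approximates_exists: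
  assumes "0 < e"
  shows "\<exists>x. approximates x y e"
proof -
  define J where "J x = q x - 2 * Re \<langle>A x, y\<rangle>" for x
  have lower: "- (M * (norm y)\<^sup>2) \<le> J x" if "x \<in> D" for x
  proof -
    have "Re \<langle>A x, y\<rangle> \<le> sqrt M * norm y * p x"
      using cmod_pairing_A[OF that, of y] complex_Re_le_cmod order_trans by blast
    \<comment> \<open>Completing the square in \<open>p x\<close> bounds the functional
      below.\<close>
    moreover have "0 \<le> (p x - sqrt M * norm y)\<^sup>2" by simp
    ultimately show ?thesis
      using that M_nonneg by (simp add: J_def power2_diff p_power2 power_mult_distrib algebra_simps)
  qed
  then have bdd: "bdd_below (J ` D)" by (rule bdd_belowI2)
  have "\<exists>j\<in>J ` D. j < Inf (J ` D) + e\<^sup>2"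
    using mem_zero assms by (intro cInf_lessD) auto
  then obtain x where x: "x \<in> D" "J x < Inf (J ` D) + e\<^sup>2" by auto
  have min: "J x - e\<^sup>2 \<le> J z" if "z \<in> D" for z
    using cINF_lower[OF bdd that] x by simp
  \<comment> \<open>First variation: a step from \<open>x\<close> along \<open>z\<close> lowers the
    functional by at most \<open>e\<^sup>2\<close>; the discriminant of this quadratic in the step
    length gives the dual estimate.\<close>
  have "cmod \<langle>A z, y - x\<rangle> \<le> e * p z" if z: "z \<in> D" for z
  proof -
    let ?w = "\<langle>A z, y - x\<rangle>"
    have "0 \<le> t\<^sup>2 * (cmod ?w)\<^sup>2 * q z - 2 * t * (cmod ?w)\<^sup>2 + e\<^sup>2" for t :: real
    proof -
      define c where "c = of_real t * cnj ?w"
      have "J x - e\<^sup>2 \<le> J (x + c *\<^sub>C z)"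
        using x z by (intro min mem_add mem_scaleC)
      also have "\<dots> = J x - 2 * Re (c * ?w) + (cmod c)\<^sup>2 * q z"
        using x z by (simp add: J_def q_add_scaleC A_add A_scaleC mem_scaleC pairing_bilinear algebra_simps)
      also have "c * ?w = of_real (t * (cmod ?w)\<^sup>2)"
        by (simp add: c_def complex_norm_square[unfolded of_real_power])
      also have "(cmod c)\<^sup>2 = t\<^sup>2 * (cmod ?w)\<^sup>2"
        by (simp add: c_def norm_mult power_mult_distrib)
      finally show ?thesis by simp
    qed
    then have "(cmod ?w)\<^sup>2 \<le> q z * e\<^sup>2"
      by (rule discriminant_le) (use z q_nonneg in auto)
    also have "\<dots> = (e * p z)\<^sup>2" using z by (simp add: power_mult_distrib p_power2)
    finally show ?thesis
      by (rule power2_le_imp_le) (use assms z p_nonneg in simp)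
  qed
  then show ?thesis using x assms unfolding approximates_def by force
qed

lemma approximates_scaleC_add:
  assumes "approximates x y e" "approximates x' y' e'"
  shows "approximates (c *\<^sub>C x + x') (c *\<^sub>C y + y') (cmod c * e + e')"
  unfolding approximates_def
proof (intro conjI ballI)
  fix z assume z: "z \<in> D"
  have "\<langle>A z, (c *\<^sub>C y + y') - (c *\<^sub>C x + x')\<rangle> = cnj c * \<langle>A z, y - x\<rangle> + \<langle>A z, y' - x'\<rangle>"
    by (simp add: pairing_bilinear algebra_simps)
  then have "cmod \<langle>A z, (c *\<^sub>C y + y') - (c *\<^sub>C x + x')\<rangle>
      \<le> cmod c * cmod \<langle>A z, y - x\<rangle> + cmod \<langle>A z, y' - x'\<rangle>"
    by (metis complex_mod_cnj norm_mult norm_triangle_ineq)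
  also have "\<dots> \<le> cmod c * (e * p z) + e' * p z"
    using assms z by (intro add_mono mult_left_mono) (auto simp: approximates_def)
  finally show "cmod \<langle>A z, (c *\<^sub>C y + y') - (c *\<^sub>C x + x')\<rangle> \<le> (cmod c * e + e') * p z"
    by (simp add: algebra_simps)
qed (use assms in \<open>auto simp: approximates_def intro: mem_add mem_scaleC\<close>)

text \<open>Triangle inequality in the completion, where \<open>J\<^sup>* y\<close> has norm at most
  \<open>sqrt M * norm y\<close>. For \<open>y = 0\<close> only the error \<open>e\<close>
  remains.\<close>

lemma approximates_p_le:
  assumes "approximates x y e"
  shows "p x \<le> sqrt M * norm y + e"
proof (rule p_le_of_dual)
  have x: "x \<in> D" and e: "0 \<le> e" and le: "cmod \<langle>A x, y - x\<rangle> \<le> e * p x"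
    using assms by (auto simp: approximates_def)
  show "x \<in> D" by fact
  show "0 \<le> sqrt M * norm y + e" using e M_nonneg by simp
  have "\<langle>A x, x\<rangle> = \<langle>A x, y\<rangle> - \<langle>A x, y - x\<rangle>" by (simp add: pairing_bilinear)
  then have "cmod \<langle>A x, x\<rangle> \<le> cmod \<langle>A x, y\<rangle> + cmod \<langle>A x, y - x\<rangle>"
    by (metis norm_triangle_ineq4)
  also have "\<dots> \<le> (sqrt M * norm y + e) * p x"
    using cmod_pairing_A[OF x, of y] le by (simp add: algebra_simps)
  finally show "cmod \<langle>A x, x\<rangle> \<le> (sqrt M * norm y + e) * p x" .
qed

lemma represents_exists: "\<exists>f. represents f y"
proof -
  define e :: "nat \<Rightarrow> real" where "e n = 1 / real (Suc n)" for n
  have "\<exists>x. approximates x y (e n)" for n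
    by (rule approximates_exists) (simp add: e_def)
  then obtain X where X: "\<And>n. approximates (X n) y (e n)" by metis
  have e: "e \<longlonglongrightarrow> 0" unfolding e_def using LIMSEQ_Suc[OF lim_1_over_n] by simp
  have XD: "X n \<in> D" for n using X by (simp add: approximates_def)
  have "norm (A (X m) - A (X n)) \<le> sqrt M * (e m + e n)" for m n
  proof -
    \<comment> \<open>The difference of two approximants of \<open>y\<close> approximates 0 with the
      summed error, hence is small for \<open>p\<close>; \<open>norm_A\<close> makes this a Cauchy
      estimate in the complete dual.\<close>
    have "approximates ((-1) *\<^sub>C X n + X m) ((-1) *\<^sub>C y + y) (cmod (-1) * e n + e m)"
      by (intro approximates_scaleC_add X)
    moreover have "(-1) *\<^sub>C v = - v" for v :: 'a
      by (metis complex_vector.scale_minus_left scaleC_one)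
    ultimately have "approximates (X m - X n) 0 (e m + e n)"
      by (simp add: add.commute)
    from approximates_p_le[OF this] have "p (X m - X n) \<le> e m + e n" by simp
    then have "sqrt M * p (X m - X n) \<le> sqrt M * (e m + e n)"
      using M_nonneg by (intro mult_left_mono) auto
    then show ?thesis
      using norm_A[OF mem_diff[OF XD XD]] by (metis A_diff XD order_trans)
  qed
  note bound = this
  have "Cauchy (\<lambda>n. A (X n))"
  proof (rule CauchyI)
    fix r :: real assume "0 < r"
    have "(\<lambda>n. sqrt M * (e n + e n)) \<longlonglongrightarrow> sqrt M * (0 + 0)"
      by (intro tendsto_intros e)
    then have "(\<lambda>n. sqrt M * (e n + e n)) \<longlonglongrightarrow> 0" by simp
    from LIMSEQ_D[OF this \<open>0 < r\<close>] obtain k where k: "sqrt M * (e k + e k) < r"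
      by (metis abs_less_iff diff_zero order_refl real_norm_def)
    have "norm (A (X m) - A (X n)) < r" if "k \<le> m" "k \<le> n" for m n
    proof -
      have "e m \<le> e k" "e n \<le> e k" using that by (auto simp: e_def frac_le)
      then have "sqrt M * (e m + e n) \<le> sqrt M * (e k + e k)"
        using M_nonneg by (intro mult_left_mono add_mono) auto
      then show ?thesis using bound[of m n] k by linarith
    qed
    then show "\<exists>k. \<forall>m\<ge>k. \<forall>n\<ge>k. norm (A (X m) - A (X n)) < r" by blast
  qed
  then obtain f where "(\<lambda>n. A (X n)) \<longlonglongrightarrow> f"
    using Cauchy_convergent convergent_def by blast
  then show ?thesis
    unfolding represents_def using e X tendsto_pairing by blast
qed

lemma represents_scaleC_add:
  assumes "represents f y" "represents g z"
  shows "represents (c *\<^sub>C f + g) (c *\<^sub>C y + z)"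
proof -
  obtain X e where X: "e \<longlonglongrightarrow> 0" "\<And>n. approximates (X n) y (e n)"
    "\<And>v. (\<lambda>n. \<langle>A (X n), v\<rangle>) \<longlonglongrightarrow> \<langle>f, v\<rangle>"
    using assms(1) unfolding represents_def by blast
  obtain Y d where Y: "d \<longlonglongrightarrow> 0" "\<And>n. approximates (Y n) z (d n)"
    "\<And>v. (\<lambda>n. \<langle>A (Y n), v\<rangle>) \<longlonglongrightarrow> \<langle>g, v\<rangle>"
    using assms(2) unfolding represents_def by blast
  have D: "X n \<in> D" "Y n \<in> D" for n using X(2) Y(2) by (auto simp: approximates_def)
  have "(\<lambda>n. cmod c * e n + d n) \<longlonglongrightarrow> cmod c * 0 + 0" by (intro tendsto_intros X Y)
  moreover have "(\<lambda>n. c * \<langle>A (X n), v\<rangle> + \<langle>A (Y n), v\<rangle>) \<longlonglongrightarrow> c * \<langle>f, v\<rangle> + \<langle>g, v\<rangle>" for v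
    by (intro tendsto_intros X Y)
  then have "(\<lambda>n. \<langle>A (c *\<^sub>C X n + Y n), v\<rangle>) \<longlonglongrightarrow> \<langle>c *\<^sub>C f + g, v\<rangle>" for v
    using D by (simp add: A_add A_scaleC mem_scaleC pairing_bilinear)
  moreover have "approximates (c *\<^sub>C X n + Y n) (c *\<^sub>C y + z) (cmod c * e n + d n)" for n
    by (intro approximates_scaleC_add X Y)
  ultimately show ?thesis
    unfolding represents_def
    by (intro exI[of _ "\<lambda>n. c *\<^sub>C X n + Y n"] exI[of _ "\<lambda>n. cmod c * e n + d n"]) simp
qed

text \<open>Each of the factors \<open>J\<close> and \<open>J\<^sup>*\<close> contributes
  \<open>sqrt M\<close>.\<close>

lemma represents_norm_le:
  assumes "represents f y"
  shows "norm f \<le> M * norm y"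
proof (rule norm_antidual_le)
  obtain X e where X: "e \<longlonglongrightarrow> 0" "\<And>n. approximates (X n) y (e n)"
    "\<And>v. (\<lambda>n. \<langle>A (X n), v\<rangle>) \<longlonglongrightarrow> \<langle>f, v\<rangle>"
    using assms(1) unfolding represents_def by blast
  fix v
  have le: "cmod \<langle>A (X n), v\<rangle> \<le> sqrt M * norm v * (sqrt M * norm y + e n)" for n
  proof -
    have "X n \<in> D" using X(2) by (simp add: approximates_def)
    then have "cmod \<langle>A (X n), v\<rangle> \<le> sqrt M * norm v * p (X n)" by (rule cmod_pairing_A)
    also have "\<dots> \<le> sqrt M * norm v * (sqrt M * norm y + e n)"
      using approximates_p_le[OF X(2)] M_nonneg by (intro mult_left_mono) auto
    finally show ?thesis .
  qed
  have "(\<lambda>n. sqrt M * norm v * (sqrt M * norm y + e n)) \<longlonglongrightarrow> sqrt M * norm v * (sqrt M * norm y + 0)"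
    by (intro tendsto_intros X(1))
  then have "cmod \<langle>f, v\<rangle> \<le> sqrt M * norm v * (sqrt M * norm y + 0)"
    by (rule LIMSEQ_le[OF tendsto_norm[OF X(3)]]) (use le in blast)
  also have "\<dots> = M * norm y * norm v" using M_nonneg by simp
  finally show "cmod \<langle>f, v\<rangle> \<le> M * norm y * norm v" .
qed (simp add: M_nonneg)

text \<open>By linearity \<open>f - g\<close> represents 0, and the norm bound then makes it
  vanish.\<close>

lemma represents_unique:
  assumes "represents f y" "represents g y"
  shows "f = g"
proof -
  have eq: "(-1) *\<^sub>C v = - v" for v :: "'b::complex_vector"
    by (metis complex_vector.scale_minus_left scaleC_one)
  have "represents (f - g) 0"
    using represents_scaleC_add[OF assms(2,1), of "-1"] by (simp add: eq)
  from represents_norm_le[OF this] show ?thesis by simp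
qed

text \<open>The constant sequence \<open>x\<close> approximates with error 0; this is why
  \<open>krein\<close> extends \<open>A\<close>.\<close>

lemma represents_A: "x \<in> D \<Longrightarrow> represents (A x) x"
  unfolding represents_def approximates_def
  by (rule exI[of _ "\<lambda>_. x"], rule exI[of _ "\<lambda>_. 0"]) (simp add: pairing_bilinear)

text \<open>Testing the approximation at \<open>z = X n\<close> bounds the difference of the two
  sequences by \<open>e n * p (X n)\<close>, and \<open>p (X n)\<close> stays bounded.\<close>

lemma represents_pairing_self:
  assumes "e \<longlonglongrightarrow> 0" "\<And>n. approximates (X n) y (e n)"
    "(\<lambda>n. \<langle>A (X n), y\<rangle>) \<longlonglongrightarrow> \<langle>f, y\<rangle>"
  shows "(\<lambda>n. complex_of_real (q (X n))) \<longlonglongrightarrow> \<langle>f, y\<rangle>"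
proof -
  have "cmod (\<langle>A (X n), y\<rangle> - q (X n)) \<le> e n * (sqrt M * norm y + e n)" for n
  proof -
    have X: "X n \<in> D" "0 \<le> e n" "cmod \<langle>A (X n), y - X n\<rangle> \<le> e n * p (X n)"
      using assms(2)[of n] by (auto simp: approximates_def)
    have "\<langle>A (X n), y\<rangle> - q (X n) = \<langle>A (X n), y - X n\<rangle>"
      using X by (simp add: pairing_bilinear pairing_self)
    moreover have "e n * p (X n) \<le> e n * (sqrt M * norm y + e n)"
      using approximates_p_le[OF assms(2)] X by (intro mult_left_mono) auto
    ultimately show ?thesis using X by simp
  qed
  moreover have "(\<lambda>n. e n * (sqrt M * norm y + e n)) \<longlonglongrightarrow> 0 * (sqrt M * norm y + 0)"
    by (intro tendsto_intros assms)
  ultimately have "(\<lambda>n. \<langle>A (X n), y\<rangle> - q (X n)) \<longlonglongrightarrow> 0"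
    using Lim_null_comparison[of "\<lambda>n. \<langle>A (X n), y\<rangle> - q (X n)" "\<lambda>n. e n * (sqrt M * norm y + e n)"]
    by (simp add: always_eventually)
  from tendsto_diff[OF assms(3) this] show ?thesis by simp
qed

lemma represents_nonneg:
  assumes "represents f y"
  shows "0 \<le> \<langle>f, y\<rangle>"
proof -
  obtain X e where X: "e \<longlonglongrightarrow> 0" "\<And>n. approximates (X n) y (e n)"
    "\<And>v. (\<lambda>n. \<langle>A (X n), v\<rangle>) \<longlonglongrightarrow> \<langle>f, v\<rangle>"
    using assms(1) unfolding represents_def by blast
  note lim = represents_pairing_self[OF X]
  have "0 \<le> q (X n)" for n using X(2) by (simp add: approximates_def q_nonneg)
  then have "0 \<le> Re \<langle>f, y\<rangle>"
    using tendsto_Re[OF lim] by (intro LIMSEQ_le_const) auto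
  moreover have "Im \<langle>f, y\<rangle> = 0"
    using tendsto_Im[OF lim] by (simp add: LIMSEQ_const_iff)
  ultimately show ?thesis by (simp add: less_eq_complex_def)
qed

lemma represents_le:
  assumes "represents f y" "positive_extension D A T"
  shows "Re \<langle>f, y\<rangle> \<le> Re \<langle>T y, y\<rangle>"
proof -
  obtain X e where X: "e \<longlonglongrightarrow> 0" "\<And>n. approximates (X n) y (e n)"
    "\<And>v. (\<lambda>n. \<langle>A (X n), v\<rangle>) \<longlonglongrightarrow> \<langle>f, v\<rangle>"
    using assms(1) unfolding represents_def by blast
  note lim = represents_pairing_self[OF X]
  \<comment> \<open>The extension \<open>T\<close> has its own semi-inner product on all of the
    space, so Cauchy-Schwarz applies to the pair \<open>X n\<close>, \<open>y\<close> although
    \<open>y\<close> may lie outside \<open>D\<close>.\<close>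
  interpret T: positive_form UNIV T
    using assms(2) by unfold_locales (auto simp: positive_extension_def bounded_clinear_def)
  let ?s = "Re \<langle>f, y\<rangle>" and ?t = "Re \<langle>T y, y\<rangle>"
  have "(Re \<langle>A (X n), y\<rangle>)\<^sup>2 \<le> q (X n) * ?t" for n
  proof -
    have "T (X n) = A (X n)"
      using assms(2) X(2) by (simp add: positive_extension_def approximates_def)
    then have "(cmod \<langle>A (X n), y\<rangle>)\<^sup>2 \<le> q (X n) * ?t"
      using T.cauchy_schwarz_power2[of "X n" y] by (simp add: q_def T.q_def)
    moreover have "(Re \<langle>A (X n), y\<rangle>)\<^sup>2 \<le> (cmod \<langle>A (X n), y\<rangle>)\<^sup>2"
      by (simp add: cmod_power2)
    ultimately show ?thesis by linarith
  qed
  moreover have "(\<lambda>n. (Re \<langle>A (X n), y\<rangle>)\<^sup>2) \<longlonglongrightarrow> ?s\<^sup>2" by (intro tendsto_intros X)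
  moreover have "(\<lambda>n. q (X n) * ?t) \<longlonglongrightarrow> ?s * ?t"
    using tendsto_Re[OF lim] by (intro tendsto_intros) simp
  \<comment> \<open>Both \<open>Re \<langle>A (X n), y\<rangle>\<close> and \<open>q (X n)\<close>
    tend to \<open>?s\<close>; cancelling one \<open>?s\<close> then leaves the claim.\<close>
  ultimately have "?s\<^sup>2 \<le> ?s * ?t" by (intro LIMSEQ_le) auto
  moreover have "0 \<le> ?s" "0 \<le> ?t"
    using represents_nonneg[OF assms(1)] T.q_nonneg[of y] by (auto simp: less_eq_complex_def T.q_def)
  ultimately show ?thesis by (cases "?s = 0") (auto simp: power2_eq_square)
qed

definition krein :: "'a \<Rightarrow> 'a antidual" where "krein y = (THE f. represents f y)"

lemma represents_krein: "represents (krein y) y"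
  unfolding krein_def using represents_exists represents_unique by (metis theI)

lemma krein_eqI: "represents f y \<Longrightarrow> krein y = f"
  using represents_krein represents_unique by blast

lemma norm_krein_le: "norm (krein y) \<le> M * norm y"
  by (rule represents_norm_le[OF represents_krein])

lemma bounded_clinear_krein: "bounded_clinear krein"
proof -
  have lin: "krein (c *\<^sub>C x + y) = c *\<^sub>C krein x + krein y" for c x y
    by (intro krein_eqI represents_scaleC_add represents_krein)
  have add: "krein (x + y) = krein x + krein y" for x y
    using lin[of 1 x y] by (simp add: scaleC_one)
  have zero: "krein 0 = 0" using add[of 0 0] by simp
  have scale: "krein (c *\<^sub>C x) = c *\<^sub>C krein x" for c x
    using lin[of c x 0] by (simp add: zero)
  have "bounded_linear krein"
    by (rule bounded_linear_intro[of _ M])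
      (use norm_krein_le in \<open>auto simp: add scale scaleR_scaleC mult.commute\<close>)
  then show ?thesis by (simp add: bounded_clinear_def clinear_on_def add scale)
qed

lemma onorm_krein_le: "onorm krein \<le> M"
  by (rule onorm_bound) (simp_all add: M_nonneg norm_krein_le)

lemma krein_von_neumann_krein: "krein_von_neumann_extension D A krein"
  unfolding krein_von_neumann_extension_def
proof (intro conjI allI impI)
  show "positive_extension D A krein"
    unfolding positive_extension_def positive_on_def
    using bounded_clinear_krein represents_nonneg[OF represents_krein] krein_eqI[OF represents_A]
    by auto
  fix T assume T: "positive_extension D A T"
  \<comment> \<open>The complex order in \<open>op_le\<close> also asks for a vanishing imaginary
    part, which positivity of both operators supplies.\<close>
  then have "0 \<le> \<langle>T y, y\<rangle>" for y by (simp add: positive_extension_def positive_on_def)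
  then show "op_le krein T"
    using represents_le[OF represents_krein T] represents_nonneg[OF represents_krein]
    unfolding op_le_def by (auto simp: pairing_bilinear less_eq_complex_def)
qed

section \<open>Operators intertwined by \<open>A\<close>\<close>

text \<open>The product \<open>S = B C\<close> is symmetric for the form, so \<open>p (S\<^sup>n x)\<close> is log-convex in \<open>n\<close>; its
  exponential growth rate, which is governed by the norm of \<open>E\<close>, therefore already bounds \<open>S\<close>
  for the seminorm \<open>p\<close>.\<close>

lemma p_intertwiner_le:
  assumes B: "bounded_clinear B" "B ` D \<subseteq> D" and C: "bounded_clinear C" "C ` D \<subseteq> D"
    and CA: "\<And>x. x \<in> D \<Longrightarrow> cadjoint C (A x) = A (B x)"
    and BA: "\<And>x. x \<in> D \<Longrightarrow> cadjoint B (A x) = A (C x)"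
  shows "\<exists>K\<ge>0. \<forall>x\<in>D. p (C x) \<le> K * p x"
proof -
  define S where "S x = B (C x)" for x
  define K where "K = onorm S"
  have AB: "\<langle>A (B x), z\<rangle> = \<langle>A x, C z\<rangle>" if "x \<in> D" for x z
    using CA[OF that] pairing_cadjoint[OF C(1)] by metis
  have AC: "\<langle>A (C x), z\<rangle> = \<langle>A x, B z\<rangle>" if "x \<in> D" for x z
    using BA[OF that] pairing_cadjoint[OF B(1)] by metis
  have CD: "C x \<in> D" and SD: "S x \<in> D" if "x \<in> D" for x
    using that B C by (auto simp: S_def)
  have AS: "\<langle>A (S x), z\<rangle> = \<langle>A x, S z\<rangle>" if "x \<in> D" for x z
    using that by (simp add: S_def AB AC CD)
  have S: "bounded_linear S"
    using bounded_clinear_compose[OF B(1) C(1)] by (simp add: S_def[abs_def] bounded_clinear_def)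
  have K: "0 \<le> K" unfolding K_def by (rule onorm_pos_le[OF S])
  have pS: "p (S x) \<le> K * p x" if x: "x \<in> D" for x
  proof -
    define a where "a n = p ((S ^^ n) x)" for n
    have D: "(S ^^ n) x \<in> D" for n by (induction n) (auto simp: x SD)
    have "norm ((S ^^ n) x) \<le> K ^ n * norm x" for n
    proof (induction n)
      case (Suc n)
      have "norm ((S ^^ Suc n) x) \<le> K * norm ((S ^^ n) x)"
        using onorm[OF S] by (simp add: K_def)
      also have "\<dots> \<le> K * (K ^ n * norm x)" using Suc K by (intro mult_left_mono)
      finally show ?case by simp
    qed simp
    \<comment> \<open>The seminorm \<open>p\<close> is dominated by the norm of the space, so
      \<open>a n\<close> inherits the rate \<open>K ^ n\<close>; the constant in front does not
      affect \<open>log_convex_le\<close>.\<close>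
    then have "sqrt M * norm ((S ^^ n) x) \<le> sqrt M * (K ^ n * norm x)" for n
      using M_nonneg by (intro mult_left_mono) auto
    then have bound: "a n \<le> sqrt M * norm x * K ^ n" for n
      using p_le_norm[OF D[of n]] unfolding a_def by (smt (verit) mult.assoc mult.commute)
    have conv: "(a (Suc n))\<^sup>2 \<le> a n * a (Suc (Suc n))" for n
    proof -
      \<comment> \<open>Symmetry moves one \<open>S\<close> from the left argument to the right, so
        Cauchy-Schwarz compares the neighbours \<open>n\<close> and \<open>n + 2\<close>.\<close>
      have "complex_of_real ((a (Suc n))\<^sup>2) = \<langle>A ((S ^^ n) x), (S ^^ Suc (Suc n)) x\<rangle>"
        using D AS[OF D[of n]] pairing_self[OF D[of "Suc n"]] p_power2[OF D[of "Suc n"]]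
        by (simp add: a_def)
      then have "(a (Suc n))\<^sup>2 = cmod \<langle>A ((S ^^ n) x), (S ^^ Suc (Suc n)) x\<rangle>"
        by (metis abs_of_nonneg norm_of_real zero_le_power2)
      also have "\<dots> \<le> a n * a (Suc (Suc n))"
        unfolding a_def by (intro cauchy_schwarz D)
      finally show ?thesis .
    qed
    have "a 1 \<le> K * a 0"
      by (rule log_convex_le[OF _ conv bound K]) (simp add: a_def p_nonneg D)
    then show ?thesis by (simp add: a_def)
  qed
  \<comment> \<open>Moving \<open>C\<close> across the form gives
    \<open>(p (C x))\<^sup>2 = \<langle>A x, S x\<rangle>\<close>, so the bound \<open>K\<close> for
    \<open>S\<close> yields \<open>sqrt K\<close> for \<open>C\<close>.\<close>
  have "p (C x) \<le> sqrt K * p x" if x: "x \<in> D" for x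
  proof (rule power2_le_imp_le)
    have "complex_of_real ((p (C x))\<^sup>2) = \<langle>A x, S x\<rangle>"
      using x by (simp add: S_def AC CD p_power2 flip: pairing_self)
    then have "(p (C x))\<^sup>2 = cmod \<langle>A x, S x\<rangle>"
      by (metis abs_of_nonneg norm_of_real zero_le_power2)
    also have "\<dots> \<le> p x * p (S x)" using x SD by (intro cauchy_schwarz)
    also have "\<dots> \<le> p x * (K * p x)" using x pS by (intro mult_left_mono) (auto simp: p_nonneg)
    finally show "(p (C x))\<^sup>2 \<le> (sqrt K * p x)\<^sup>2"
      using K by (simp add: power_mult_distrib) (simp add: power2_eq_square algebra_simps)
  qed (use x K in \<open>simp add: p_nonneg\<close>)
  then show ?thesis using K by (intro exI[of _ "sqrt K"]) simp
qed

text \<open>\<open>B\<close> sends approximants of \<open>y\<close> to approximants of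
  \<open>B y\<close>, and \<open>A (B (X n)) = cadjoint C (A (X n))\<close> converges pointwise to
  \<open>cadjoint C (krein y)\<close>. Uniqueness of the represented functional finishes.\<close>

lemma krein_intertwines:
  assumes B: "bounded_clinear B" "B ` D \<subseteq> D" and C: "bounded_clinear C" "C ` D \<subseteq> D"
    and CA: "\<And>x. x \<in> D \<Longrightarrow> cadjoint C (A x) = A (B x)"
    and BA: "\<And>x. x \<in> D \<Longrightarrow> cadjoint B (A x) = A (C x)"
  shows "cadjoint C (krein y) = krein (B y)"
proof -
  obtain K where K: "0 \<le> K" "\<And>x. x \<in> D \<Longrightarrow> p (C x) \<le> K * p x"
    using p_intertwiner_le[OF assms] by blast
  obtain X e where X: "e \<longlonglongrightarrow> 0" "\<And>n. approximates (X n) y (e n)"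
    "\<And>v. (\<lambda>n. \<langle>A (X n), v\<rangle>) \<longlonglongrightarrow> \<langle>krein y, v\<rangle>"
    using represents_krein[of y] unfolding represents_def by blast
  have XD: "X n \<in> D" and e: "0 \<le> e n" for n using X(2) by (auto simp: approximates_def)
  have "approximates (B (X n)) (B y) (e n * K)" for n
    unfolding approximates_def
  proof (intro conjI ballI)
    fix z assume z: "z \<in> D"
    have CzD: "C z \<in> D" using z C by auto
    have "B y - B (X n) = B (y - X n)"
      using B(1) by (simp add: bounded_clinear_def linear_diff bounded_linear.linear)
    \<comment> \<open>\<open>B\<close> crosses the form as \<open>C\<close> acting on
      \<open>z\<close>, which is where the \<open>p\<close>-bound of \<open>C\<close> is
      used.\<close>
    then have "\<langle>A z, B y - B (X n)\<rangle> = \<langle>A (C z), y - X n\<rangle>"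
      using BA[OF z] pairing_cadjoint[OF B(1)] by metis
    then have "cmod \<langle>A z, B y - B (X n)\<rangle> \<le> e n * p (C z)"
      using X(2)[of n] CzD by (simp add: approximates_def)
    also have "\<dots> \<le> e n * (K * p z)" using K z e by (intro mult_left_mono)
    finally show "cmod \<langle>A z, B y - B (X n)\<rangle> \<le> e n * K * p z" by simp
  qed (use XD B e K in auto)
  moreover have "(\<lambda>n. e n * K) \<longlonglongrightarrow> 0" using X(1) by (rule tendsto_mult_left_zero)
  moreover have "(\<lambda>n. \<langle>A (B (X n)), v\<rangle>) \<longlonglongrightarrow> \<langle>cadjoint C (krein y), v\<rangle>" for v
    using X(3)[of "C v"] by (simp add: pairing_cadjoint[OF C(1)] XD flip: CA)
  ultimately have "represents (cadjoint C (krein y)) (B y)"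
    unfolding represents_def by (intro exI[of _ "\<lambda>n. B (X n)"] exI[of _ "\<lambda>n. e n * K"]) simp
  then show ?thesis by (rule krein_eqI[symmetric])
qed

end

section \<open>Uniqueness of the smallest extension and necessity of the norm estimate\<close>

text \<open>The difference is a positive operator with zero diagonal, and Cauchy-Schwarz kills its
  off-diagonal values.\<close>

lemma op_le_antisym:
  assumes S: "bounded_clinear S" and T: "bounded_clinear T" and "op_le S T" "op_le T S"
  shows "S = T"
proof -
  define R where "R x = T x - S x" for x
  have lin: "clinear_on UNIV R"
    using S T by (simp add: R_def bounded_clinear_def clinear_on_def complex_vector.scale_right_diff_distrib)
  have "positive_form UNIV R"
    using assms lin by unfold_locales (auto simp: R_def op_le_def positive_on_def)
  then interpret R: positive_form UNIV R .
  have "R.q x = 0" for x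
  proof -
    have "0 \<le> Re \<langle>R x, x\<rangle>" using assms(3) by (simp add: op_le_def R_def less_eq_complex_def)
    moreover have "0 \<le> Re \<langle>S x - T x, x\<rangle>" using assms(4) by (simp add: op_le_def less_eq_complex_def)
    ultimately show ?thesis by (simp add: R.q_def R_def pairing_bilinear)
  qed
  then have "\<langle>R x, y\<rangle> = 0" for x y using R.cauchy_schwarz_power2[of x y] by simp
  then have "\<langle>S x, y\<rangle> = \<langle>T x, y\<rangle>" for x y by (simp add: R_def pairing_bilinear)
  then show ?thesis by (intro ext pairing_eqI)
qed

lemma krein_von_neumann_unique:
  assumes "krein_von_neumann_extension D A N" "krein_von_neumann_extension D A N'"
  shows "N = N'"
proof (rule op_le_antisym)
  show "op_le N N'" "op_le N' N" "bounded_clinear N" "bounded_clinear N'"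
    using assms unfolding krein_von_neumann_extension_def positive_extension_def by blast+
qed

text \<open>Cauchy-Schwarz for \<open>T\<close> with
  \<open>\<langle>T y, y\<rangle> \<le> onorm T * (norm y)\<^sup>2\<close>, followed by the supremum
  over \<open>y\<close>. So \<open>onorm T\<close> is an admissible constant in (ii).\<close>

lemma positive_extension_norm_le:
  assumes "positive_extension D A T" "x \<in> D"
  shows "(norm (A x))\<^sup>2 \<le> onorm T * Re \<langle>A x, x\<rangle>"
proof -
  interpret T: positive_form UNIV T
    using assms by unfold_locales (auto simp: positive_extension_def bounded_clinear_def)
  have bl: "bounded_linear T" and eq: "T x = A x"
    using assms by (auto simp: positive_extension_def bounded_clinear_def)
  have q: "0 \<le> T.q x" by (simp add: T.q_nonneg)
  have o: "0 \<le> onorm T" by (rule onorm_pos_le[OF bl])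
  have "norm (A x) \<le> sqrt (onorm T * T.q x)"
  proof (rule norm_antidual_le)
    fix y
    have "T.q y \<le> cmod \<langle>T y, y\<rangle>" by (simp add: T.q_def complex_Re_le_cmod)
    also have "\<dots> \<le> norm (T y) * norm y" by (rule cmod_pairing_le)
    also have "\<dots> \<le> onorm T * norm y * norm y" by (intro mult_right_mono onorm[OF bl]) simp
    finally have "T.q x * T.q y \<le> T.q x * (onorm T * norm y * norm y)"
      using q by (intro mult_left_mono)
    with T.cauchy_schwarz_power2[of x y]
    have "(cmod \<langle>A x, y\<rangle>)\<^sup>2 \<le> (sqrt (onorm T * T.q x) * norm y)\<^sup>2"
      using q o eq by (simp add: power_mult_distrib power2_eq_square algebra_simps)
    then show "cmod \<langle>A x, y\<rangle> \<le> sqrt (onorm T * T.q x) * norm y"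
      by (rule power2_le_imp_le) (use q o in simp)
  qed (use q o in simp)
  then have "(norm (A x))\<^sup>2 \<le> (sqrt (onorm T * T.q x))\<^sup>2" by (rule power_mono) simp
  then show ?thesis using q o eq by (simp add: T.q_def)
qed

lemma bounded_positive_formI:
  assumes "csubspace D" "clinear_on D A" "0 \<le> M"
    and "\<And>x. x \<in> D \<Longrightarrow> complex_of_real ((norm (A x))\<^sup>2) \<le> complex_of_real M * \<langle>A x, x\<rangle>"
  shows "bounded_positive_form D A M"
proof -
  have pos: "0 \<le> \<langle>A x, x\<rangle>" if "x \<in> D" for x
  proof (cases "A x = 0")
    case False
    then show ?thesis
      by (intro nonneg_if_le_mult[OF assms(4)[OF that] _ assms(3)]) simp
  qed (simp add: pairing_bilinear)
  then interpret positive_form D A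
    using assms by unfold_locales (auto simp: positive_on_def)
  show ?thesis
  proof unfold_locales
    fix x assume x: "x \<in> D"
    show "(norm (A x))\<^sup>2 \<le> M * q x"
      using assms(4)[OF x] pos[OF x] unfolding q_def
      by (simp add: complex_of_real_le_mult_iff del: of_real_power)
  qed (fact assms(3))
qed

section \<open>Uniform boundedness\<close>

text \<open>Baire category for the sets \<open>F n\<close> of those \<open>y\<close> at which every
  \<open>A x\<close> is bounded by \<open>n * s x\<close>. The weight \<open>s x\<close> stays on
  the right, so no functional is divided by a weight that may be 0.\<close>

lemma pointwise_bounded_imp_bounded:
  fixes D :: "'a::cbanach set" and A :: "'a \<Rightarrow> 'a antidual"
  assumes pw: "\<And>y. \<exists>M\<ge>0. \<forall>x\<in>D. complex_of_real ((cmod \<langle>A x, y\<rangle>)\<^sup>2) \<le> complex_of_real M * \<langle>A x, x\<rangle>"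
  shows "\<exists>M\<ge>0. \<forall>x\<in>D. complex_of_real ((norm (A x))\<^sup>2) \<le> complex_of_real M * \<langle>A x, x\<rangle>"
proof -
  have pos: "0 \<le> \<langle>A x, x\<rangle>" if x: "x \<in> D" for x
  proof (cases "A x = 0")
    case False
    then obtain y where y: "\<langle>A x, y\<rangle> \<noteq> 0"
      using pairing_eqI[of "A x" 0] by (auto simp: pairing_bilinear)
    obtain M where M: "0 \<le> M" "complex_of_real ((cmod \<langle>A x, y\<rangle>)\<^sup>2) \<le> complex_of_real M * \<langle>A x, x\<rangle>"
      using pw[of y] x by blast
    from y show ?thesis by (intro nonneg_if_le_mult[OF M(2) _ M(1)]) simp
  qed (simp add: pairing_bilinear)
  define s where "s x = sqrt (Re \<langle>A x, x\<rangle>)" for x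
  have s: "0 \<le> s x" "(s x)\<^sup>2 = Re \<langle>A x, x\<rangle>" if "x \<in> D" for x
    using pos[OF that] by (auto simp: s_def less_eq_complex_def)
  define F where "F n = (\<Inter>x\<in>D. {y. cmod \<langle>A x, y\<rangle> \<le> real n * s x})" for n
  have closed: "closed (F n)" for n
    unfolding F_def
    by (intro closed_INT ballI closed_Collect_le continuous_intros
        bounded_linear.continuous_on[OF bounded_linear_pairing])
  have cover: "\<exists>n. y \<in> F n" for y
  proof -
    obtain M where M: "0 \<le> M" "\<And>x. x \<in> D \<Longrightarrow> (cmod \<langle>A x, y\<rangle>)\<^sup>2 \<le> M * Re \<langle>A x, x\<rangle>"
      using pw[of y] pos by (auto simp: complex_of_real_le_mult_iff simp del: of_real_power)
    obtain n where n: "sqrt M \<le> real n" using real_arch_simple by blast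
    have "cmod \<langle>A x, y\<rangle> \<le> real n * s x" if x: "x \<in> D" for x
    proof -
      have "(cmod \<langle>A x, y\<rangle>)\<^sup>2 \<le> (sqrt M * s x)\<^sup>2"
        using M s x by (simp add: power_mult_distrib)
      then have "cmod \<langle>A x, y\<rangle> \<le> sqrt M * s x"
        by (rule power2_le_imp_le) (use M s x in simp)
      also have "\<dots> \<le> real n * s x" using n s x by (intro mult_right_mono)
      finally show ?thesis .
    qed
    then show ?thesis by (auto simp: F_def)
  qed
  have "\<exists>n. interior (F n) \<noteq> {}"
  proof (rule ccontr)
    assume "\<not> (\<exists>n. interior (F n) \<noteq> {})"
    \<comment> \<open>Completeness of the space enters here.\<close>
    then have "euclidean interior_of \<Union>(range F) = {}"
      using closed by (intro Baire_category_alt disjI1 completely_metrizable_space_euclidean) auto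
    moreover have "\<Union>(range F) = UNIV" using cover by auto
    ultimately show False by simp
  qed
  then obtain n y0 r where r: "0 < r" "cball y0 r \<subseteq> F n"
    by (metis all_not_in_conv mem_interior_cball)
  have "(norm (A x))\<^sup>2 \<le> (real n / r)\<^sup>2 * Re \<langle>A x, x\<rangle>" if x: "x \<in> D" for x
  proof -
    \<comment> \<open>Writing \<open>2 v = (y0 + v) - (y0 - v)\<close> carries the bound from the
      ball around \<open>y0\<close> to the ball around 0.\<close>
    have small: "cmod \<langle>A x, v\<rangle> \<le> real n * s x" if v: "norm v \<le> r" for v
    proof -
      have "y0 + v \<in> F n" "y0 - v \<in> F n" using r(2) v by (auto simp: subset_iff dist_norm)
      then have "cmod \<langle>A x, y0 + v\<rangle> \<le> real n * s x" "cmod \<langle>A x, y0 - v\<rangle> \<le> real n * s x"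
        using x by (auto simp: F_def)
      moreover have "2 * \<langle>A x, v\<rangle> = \<langle>A x, y0 + v\<rangle> - \<langle>A x, y0 - v\<rangle>"
        by (simp add: pairing_bilinear)
      then have "2 * cmod \<langle>A x, v\<rangle> \<le> cmod \<langle>A x, y0 + v\<rangle> + cmod \<langle>A x, y0 - v\<rangle>"
        by (metis norm_mult norm_numeral norm_triangle_ineq4)
      ultimately show ?thesis by linarith
    qed
    have "norm (A x) \<le> real n / r * s x"
    proof (rule norm_antidual_le)
      fix v
      show "cmod \<langle>A x, v\<rangle> \<le> real n / r * s x * norm v"
      proof (cases "v = 0")
        case False
        have "cmod \<langle>A x, complex_of_real (r / norm v) *\<^sub>C v\<rangle> \<le> real n * s x"
          using False r by (intro small) (simp add: norm_scaleC norm_divide)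
        then show ?thesis
          using False r by (simp add: pairing_bilinear norm_mult norm_divide field_simps)
      qed (simp add: pairing_bilinear)
    qed (use r s x in auto)
    then have "(norm (A x))\<^sup>2 \<le> (real n / r * s x)\<^sup>2" by (rule power_mono) simp
    then show ?thesis using s x by (simp add: power_mult_distrib power_divide)
  qed
  then show ?thesis
    using pos by (intro exI[of _ "(real n / r)\<^sup>2"]) (auto simp: complex_of_real_le_mult_iff simp del: of_real_power)
qed

section \<open>Equivalence, norm formula and intertwining relations\<close>

theorem theorem4p2:
  fixes D :: "'a::cbanach set" and A :: "'a \<Rightarrow> 'a antidual"
  assumes "csubspace D" and "clinear_on D A"
  shows
    "((\<exists>T. positive_extension D A T) \<longleftrightarrow>
      (\<exists>M\<ge>0. \<forall>x\<in>D. complex_of_real ((norm (A x))\<^sup>2) \<le> complex_of_real M * \<langle>A x, x\<rangle>)) \<and>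
    ((\<exists>T. positive_extension D A T) \<longleftrightarrow>
      (\<forall>y. \<exists>M\<ge>0. \<forall>x\<in>D. complex_of_real ((cmod \<langle>A x, y\<rangle>)\<^sup>2) \<le> complex_of_real M * \<langle>A x, x\<rangle>)) \<and>
    ((\<exists>T. positive_extension D A T) \<longrightarrow>
      (\<exists>!N. krein_von_neumann_extension D A N) \<and>
      (\<forall>N. krein_von_neumann_extension D A N \<longrightarrow>
        onorm N = Inf {M. 0 \<le> M \<and>
          (\<forall>x\<in>D. complex_of_real ((norm (A x))\<^sup>2) \<le> complex_of_real M * \<langle>A x, x\<rangle>)} \<and>
        (\<forall>B C. bounded_clinear B \<and> bounded_clinear C \<and> B ` D \<subseteq> D \<and> C ` D \<subseteq> D \<and>
          (\<forall>x\<in>D. cadjoint C (A x) = A (B x)) \<and> (\<forall>x\<in>D. cadjoint B (A x) = A (C x)) \<longrightarrow>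
          cadjoint C \<circ> N = N \<circ> B \<and> cadjoint B \<circ> N = N \<circ> C)))"
proof -
  let ?pe = "\<exists>T. positive_extension D A T"
  let ?bd = "\<lambda>M. 0 \<le> M \<and>
    (\<forall>x\<in>D. complex_of_real ((norm (A x))\<^sup>2) \<le> complex_of_real M * \<langle>A x, x\<rangle>)"
  let ?pw = "\<forall>y. \<exists>M\<ge>0. \<forall>x\<in>D. complex_of_real ((cmod \<langle>A x, y\<rangle>)\<^sup>2) \<le> complex_of_real M * \<langle>A x, x\<rangle>"
  have form: "bounded_positive_form D A M" if "?bd M" for M
    using bounded_positive_formI[OF assms] that by blast
  have bd_onorm: "?bd (onorm T)" if T: "positive_extension D A T" for T
  proof -
    have "0 \<le> \<langle>A x, x\<rangle>" if "x \<in> D" for x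
      using T that by (metis UNIV_I positive_extension_def positive_on_def)
    moreover have "0 \<le> onorm T"
      using T by (simp add: positive_extension_def bounded_clinear_def onorm_pos_le)
    ultimately show ?thesis
      using positive_extension_norm_le[OF T] by (auto simp: complex_of_real_le_mult_iff simp del: of_real_power)
  qed
  have bd_pe: ?pe if "?bd M" for M
  proof -
    interpret bounded_positive_form D A M using form[OF that] .
    show ?thesis using krein_von_neumann_krein by (auto simp: krein_von_neumann_extension_def)
  qed
  have pe_pw: ?pw if ?pe
  proof
    fix y
    from that obtain M where M: "?bd M" using bd_onorm by blast
    interpret bounded_positive_form D A M using form[OF M] .
    have "complex_of_real ((cmod \<langle>A x, y\<rangle>)\<^sup>2) \<le> complex_of_real (M * (norm y)\<^sup>2) * \<langle>A x, x\<rangle>"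
      if x: "x \<in> D" for x
    proof -
      have "(cmod \<langle>A x, y\<rangle>)\<^sup>2 \<le> (sqrt M * norm y * p x)\<^sup>2"
        by (intro power_mono cmod_pairing_A x) simp
      also have "\<dots> = M * (norm y)\<^sup>2 * q x"
        using M_nonneg x by (simp add: power_mult_distrib p_power2)
      finally show ?thesis
        using x q_nonneg[OF x]
        by (subst complex_of_real_le_mult_iff) (simp_all add: pairing_self less_eq_complex_def)
    qed
    then show "\<exists>M\<ge>0. \<forall>x\<in>D. complex_of_real ((cmod \<langle>A x, y\<rangle>)\<^sup>2) \<le> complex_of_real M * \<langle>A x, x\<rangle>"
      using M_nonneg by (intro exI[of _ "M * (norm y)\<^sup>2"]) simp
  qed
  have equiv2: "?pe \<longleftrightarrow> (\<exists>M. ?bd M)" using bd_onorm bd_pe by blast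
  \<comment> \<open>The way back from (iii) passes through (ii).\<close>
  have equiv3: "?pe \<longleftrightarrow> ?pw"
    using pe_pw bd_pe pointwise_bounded_imp_bounded[of D A] by blast
  have exists_unique: "\<exists>!N. krein_von_neumann_extension D A N" if ?pe
  proof -
    from that obtain M where M: "?bd M" using bd_onorm by blast
    interpret bounded_positive_form D A M using form[OF M] .
    show ?thesis using krein_von_neumann_krein krein_von_neumann_unique by blast
  qed
  \<comment> \<open>The infimum is attained: \<open>onorm N\<close> is admissible because
    \<open>N\<close> is a positive extension, and each admissible \<open>M\<close> builds a
    \<open>krein\<close> of norm at most \<open>M\<close>, equal to \<open>N\<close> by
    uniqueness.\<close>
  have onorm_eq: "onorm N = Inf {M. ?bd M}" if N: "krein_von_neumann_extension D A N" for N
  proof -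
    have "?bd (onorm N)" using bd_onorm N by (auto simp: krein_von_neumann_extension_def)
    moreover have "onorm N \<le> M" if "?bd M" for M
    proof -
      interpret bounded_positive_form D A M using form[OF that] .
      show ?thesis
        using onorm_krein_le krein_von_neumann_unique[OF N krein_von_neumann_krein] by simp
    qed
    ultimately show ?thesis by (intro cInf_eq_minimum[symmetric]) auto
  qed
  have intertwines: "cadjoint C \<circ> N = N \<circ> B \<and> cadjoint B \<circ> N = N \<circ> C"
    if N: "krein_von_neumann_extension D A N"
      and BC: "bounded_clinear B" "bounded_clinear C" "B ` D \<subseteq> D" "C ` D \<subseteq> D"
        "\<forall>x\<in>D. cadjoint C (A x) = A (B x)" "\<forall>x\<in>D. cadjoint B (A x) = A (C x)"
    for N B C
  proof -
    have M: "?bd (onorm N)" using bd_onorm N by (auto simp: krein_von_neumann_extension_def)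
    interpret bounded_positive_form D A "onorm N" using form[OF M] .
    have "N = krein" by (rule krein_von_neumann_unique[OF N krein_von_neumann_krein])
    \<comment> \<open>The hypotheses are symmetric in \<open>B\<close> and \<open>C\<close>, so the
      second identity is the first one with the roles exchanged.\<close>
    then show ?thesis
      using krein_intertwines[of B C] krein_intertwines[of C B] BC by (simp add: fun_eq_iff)
  qed
  show ?thesis
    using equiv2 equiv3 exists_unique onorm_eq intertwines by blast
qed

end
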